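(* Let $M$ be an almost paracontact metric 3-dimensional Walker manifold for which $\xi_3=0$ and $\xi_2=-1$. Then we have: (i) $M$ does not belong to the following classes: $\mathbb G_5$, $\mathbb G_5\oplus\mathbb G_{10}$, $\mathbb G_5\oplus\mathbb G_{12}$, $\mathbb G_5\oplus\mathbb G_{10}\oplus\mathbb G_{12}$, $\mathbb G_6$, $\mathbb G_6\oplus\mathbb G_{10}$, $\mathbb G_6\oplus\mathbb G_{12}$, $\mathbb G_6\oplus\mathbb G_{10}\oplus\mathbb G_{12}$; (ii) $M$ is paracosymplectic if and only if $(\xi_1)_x=(\xi_1)_y=0$ and $2(\xi_1)_z+\xi_1f_x-f_y=0$; (iii) $M$ is normal if and only if $(\xi_1)_x\neq0$, $(\xi_1)_y=\xi_1(\xi_1)_x$ and $2(\xi_1)_z+\xi_1f_x-f_y+(\xi_1)_x(\xi_1^2-f)=0$; (iv) $M$ is almost paracosymplectic if and only if $(\xi_1)_x=(\xi_1)_y=0$ and $2(\xi_1)_z+\xi_1f_x-f_y\neq0$; (v) $M\in\mathbb G_{12}$ if and only if $(\xi_1)_x=0$, $(\xi_1)_y\neq0$ and $2\xi_1(\xi_1)_y+2(\xi_1)_z+\xi_1f_x-f_y=0$.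
   Context: A 3-dimensional Walker manifold is a 3-dimensional Lorentzian manifold $(M,g)$ admitting a parallel lightlike distribution of rank 1. An almost paracontact metric 3-dimensional Walker manifold $(M,\varphi,\xi,\eta,g)$ is such a manifold with the structure given, in local coordinates $(x,y,z)$ and with respect to $\{\partial_x,\partial_y,\partial_z\}$, by $$g=\begin{pmatrix}0&0&1\\0&1&0\\1&0&f\end{pmatrix},\quad \varphi=\begin{pmatrix}-\xi_2&\xi_1+f\xi_3&-f\xi_2\\ \xi_3&0&-\xi_1\\0&-\xi_3&\xi_2\end{pmatrix},$$ $\xi=\xi_1\partial_x+\xi_2\partial_y+\xi_3\partial_z$, $\eta=\xi_3dx+\xi_2dy+(\xi_1+f\xi_3)dz$, where $f=f(x,y,z)\in C^\infty(M)$ and $\xi_1,\xi_2,\xi_3\in C^\infty(M)$ satisfy $\xi_2^2+f\xi_3^2+2\xi_1\xi_3=1$ (columns of $\varphi$ are the images of the basis vectors). Subscripts $x,y,z$ on functions denote partial derivatives. Let $F(X,Y,Z)=g((\nabla_X\varphi)Y,Z)$, $\nabla$ the Levi-Civita connection; $\theta_F(X)=g^{ij}F(e_i,e_j,X)$, $\theta_F^*(X)=g^{ij}F(e_i,\varphi e_j,X)$ for a local basis $\{e_i\}$. Classes in dimension 3 ($M$ is in a class if at each point $F$ satisfies the condition): $\mathbb G_5$: $F(X,Y,Z)=\frac{\theta_F(\xi)}{2}\{\eta(Y)g(\varphi X,\varphi Z)-\eta(Z)g(\varphi X,\varphi Y)\}$; $\mathbb G_6$: $F(X,Y,Z)=-\frac{\theta^*_F(\xi)}{2}\{\eta(Y)g(X,\varphi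 Z)-\eta(Z)g(X,\varphi Y)\}$; $\mathbb G_{10}$: $F(X,Y,Z)=-\eta(Y)F(X,Z,\xi)+\eta(Z)F(X,Y,\xi)$ and $F(X,Y,\xi)=F(Y,X,\xi)=F(\varphi X,\varphi Y,\xi)$; $\mathbb G_{12}$: $F(X,Y,Z)=\eta(X)\{\eta(Y)F(\xi,\xi,Z)-\eta(Z)F(\xi,\xi,Y)\}$; $\mathbb G_0$ (the intersection of all basic classes): $F=0$. In dimension 3, $F$ decomposes uniquely as $F=F^5+F^6+F^{10}+F^{12}$ with $F^i\in\mathbb G_i$; $M\in\mathbb G_i\oplus\mathbb G_j\oplus\cdots$ means $F=F^i+F^j+\cdots$, where $F^i,F^j,\dots$ are the projections of $F$ on $\mathbb G_i,\mathbb G_j,\dots$. $M$ is normal if $N(X,Y)-2d\eta(X,Y)\xi=0$ with $N(X,Y)=\varphi^2[X,Y]+[\varphi X,\varphi Y]-\varphi[\varphi X,Y]-\varphi[X,\varphi Y]$ and $d\eta(X,Y)=\frac12((\nabla_X\eta)Y-(\nabla_Y\eta)X)$; almost paracosymplectic if $d\eta=0$ and $d\phi=0$, where $\phi(X,Y)=g(\varphi X,Y)$ (in dimension 3, equivalently $M\in\mathbb G_{10}$); paracosymplectic if it is almost paracosymplectic and normal (in dimension 3, equivalently $M\in\mathbb G_0$).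
   Formalization: Since F=0 lies in every class, (i),(iii)-(v) fail literally (ξ_1=f=0); here class membership means every listed projection of F is nonzero, normal/almost paracosymplectic mean also not paracosymplectic, and "≠0" is read uniformly as somewhere or everywhere nonzero. *)

theory Defs
  imports "HOL-Analysis.Analysis"
begin

(* Points, tangent vectors and covectors are written in the coordinates (x,y,z) = (1,2,3) and the
   bases d/dx, d/dy, d/dz and dx, dy, dz. *)

definition pd :: "3 \<Rightarrow> (real^3 \<Rightarrow> real) \<Rightarrow> real^3 \<Rightarrow> real" where
  "pd i h q = frechet_derivative h (at q) (axis i 1)"

fun Ck_on :: "nat \<Rightarrow> (real^3) set \<Rightarrow> (real^3 \<Rightarrow> real) \<Rightarrow> bool" where
  "Ck_on 0 U h \<longleftrightarrow> continuous_on U h"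
| "Ck_on (Suc k) U h \<longleftrightarrow> h differentiable_on U \<and> (\<forall>i. Ck_on k U (pd i h))"

(* C-infinity; only meant for open U, where pd depends on h restricted to U only. *)
definition smooth_on :: "(real^3) set \<Rightarrow> (real^3 \<Rightarrow> real) \<Rightarrow> bool" where
  "smooth_on U h \<longleftrightarrow> (\<forall>k. Ck_on k U h)"

(* The manifold is given by the domain of a coordinate chart and the functions
   f, xi_1, xi_2, xi_3 on it; values outside the chart are irrelevant. *)
record walker =
  chart :: "(real^3) set"
  ff :: "real^3 \<Rightarrow> real"
  xi1 :: "real^3 \<Rightarrow> real"
  xi2 :: "real^3 \<Rightarrow> real"
  xi3 :: "real^3 \<Rightarrow> real"

definition apcm_walker :: "walker \<Rightarrow> bool" where
  "apcm_walker M \<longleftrightarrow> open (chart M) \<and> chart M \<noteq> {} \<and>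
     smooth_on (chart M) (ff M) \<and> smooth_on (chart M) (xi1 M) \<and>
     smooth_on (chart M) (xi2 M) \<and> smooth_on (chart M) (xi3 M) \<and>
     (\<forall>q\<in>chart M. (xi2 M q)\<^sup>2 + ff M q * (xi3 M q)\<^sup>2 + 2 * xi1 M q * xi3 M q = 1)"

definition gmat :: "walker \<Rightarrow> real^3 \<Rightarrow> real^3^3" where
  "gmat M q = vector [vector [0, 0, 1], vector [0, 1, 0], vector [1, 0, ff M q]]"

definition ginv :: "walker \<Rightarrow> real^3 \<Rightarrow> real^3^3" where
  "ginv M q = matrix_inv (gmat M q)"

definition met :: "walker \<Rightarrow> real^3 \<Rightarrow> real^3 \<Rightarrow> real^3 \<Rightarrow> real" where
  "met M q u v = u \<bullet> (gmat M q *v v)"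

(* Inner lists are rows, so the columns are the images of the basis vectors. *)
definition phi :: "walker \<Rightarrow> real^3 \<Rightarrow> real^3^3" where
  "phi M q = vector
     [vector [- xi2 M q, xi1 M q + ff M q * xi3 M q, - (ff M q * xi2 M q)],
      vector [xi3 M q, 0, - xi1 M q],
      vector [0, - xi3 M q, xi2 M q]]"

definition xi :: "walker \<Rightarrow> real^3 \<Rightarrow> real^3" where
  "xi M q = vector [xi1 M q, xi2 M q, xi3 M q]"

definition eta :: "walker \<Rightarrow> real^3 \<Rightarrow> real^3 \<Rightarrow> real" where
  "eta M q u = vector [xi3 M q, xi2 M q, xi1 M q + ff M q * xi3 M q] \<bullet> u"

type_synonym vfield = "real^3 \<Rightarrow> real^3"

definition lie :: "vfield \<Rightarrow> vfield \<Rightarrow> vfield" where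
  "lie X Y q = frechet_derivative Y (at q) (X q) - frechet_derivative X (at q) (Y q)"

definition christoffel :: "walker \<Rightarrow> 3 \<Rightarrow> 3 \<Rightarrow> 3 \<Rightarrow> real^3 \<Rightarrow> real" where
  "christoffel M k i j q = (1/2) * (\<Sum>l\<in>UNIV. ginv M q $ k $ l *
     (pd i (\<lambda>r. gmat M r $ j $ l) q + pd j (\<lambda>r. gmat M r $ i $ l) q
      - pd l (\<lambda>r. gmat M r $ i $ j) q))"

definition nabla :: "walker \<Rightarrow> vfield \<Rightarrow> vfield \<Rightarrow> vfield" where
  "nabla M X Y q = frechet_derivative Y (at q) (X q)
     + (\<chi> k. \<Sum>i\<in>UNIV. \<Sum>j\<in>UNIV. christoffel M k i j q * X q $ i * Y q $ j)"

definition phif :: "walker \<Rightarrow> vfield \<Rightarrow> vfield" where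
  "phif M X q = phi M q *v X q"

definition nabla_phi :: "walker \<Rightarrow> vfield \<Rightarrow> vfield \<Rightarrow> vfield" where
  "nabla_phi M X Y q = nabla M X (phif M Y) q - phif M (nabla M X Y) q"

definition nabla_eta :: "walker \<Rightarrow> vfield \<Rightarrow> vfield \<Rightarrow> real^3 \<Rightarrow> real" where
  "nabla_eta M X Y q = frechet_derivative (\<lambda>r. eta M r (Y r)) (at q) (X q)
     - eta M q (nabla M X Y q)"

definition d_eta :: "walker \<Rightarrow> vfield \<Rightarrow> vfield \<Rightarrow> real^3 \<Rightarrow> real" where
  "d_eta M X Y q = (1/2) * (nabla_eta M X Y q - nabla_eta M Y X q)"

definition Phi :: "walker \<Rightarrow> vfield \<Rightarrow> vfield \<Rightarrow> real^3 \<Rightarrow> real" where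
  "Phi M X Y q = met M q (phif M X q) (Y q)"

(* Exterior derivative of the 2-form Phi, in the normalisation that matches the factor 1/2
   in d_eta. *)
definition d_Phi :: "walker \<Rightarrow> vfield \<Rightarrow> vfield \<Rightarrow> vfield \<Rightarrow> real^3 \<Rightarrow> real" where
  "d_Phi M X Y Z q = (1/3) *
     (frechet_derivative (Phi M Y Z) (at q) (X q)
      + frechet_derivative (Phi M Z X) (at q) (Y q)
      + frechet_derivative (Phi M X Y) (at q) (Z q)
      - Phi M (lie X Y) Z q - Phi M (lie Y Z) X q - Phi M (lie Z X) Y q)"

definition nijenhuis :: "walker \<Rightarrow> vfield \<Rightarrow> vfield \<Rightarrow> vfield" where
  "nijenhuis M X Y q = phif M (phif M (lie X Y)) q + lie (phif M X) (phif M Y) q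
     - phif M (lie (phif M X) Y) q - phif M (lie X (phif M Y)) q"

(* N - 2 d_eta xi, d_eta, d_Phi and F are tensorial; their values on tangent vectors at q are
   obtained by extending the vectors to fields with constant coefficients. *)

definition normal_at :: "walker \<Rightarrow> real^3 \<Rightarrow> bool" where
  "normal_at M q \<longleftrightarrow> (\<forall>u v.
     nijenhuis M (\<lambda>_. u) (\<lambda>_. v) q - (2 * d_eta M (\<lambda>_. u) (\<lambda>_. v) q) *\<^sub>R xi M q = 0)"

definition almost_paracosymplectic_at :: "walker \<Rightarrow> real^3 \<Rightarrow> bool" where
  "almost_paracosymplectic_at M q \<longleftrightarrow>
     (\<forall>u v. d_eta M (\<lambda>_. u) (\<lambda>_. v) q = 0) \<and>
     (\<forall>u v w. d_Phi M (\<lambda>_. u) (\<lambda>_. v) (\<lambda>_. w) q = 0)"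

definition paracosymplectic_at :: "walker \<Rightarrow> real^3 \<Rightarrow> bool" where
  "paracosymplectic_at M q \<longleftrightarrow> almost_paracosymplectic_at M q \<and> normal_at M q"

definition normal :: "walker \<Rightarrow> bool" where
  "normal M \<longleftrightarrow> (\<forall>q\<in>chart M. normal_at M q)"

definition almost_paracosymplectic :: "walker \<Rightarrow> bool" where
  "almost_paracosymplectic M \<longleftrightarrow> (\<forall>q\<in>chart M. almost_paracosymplectic_at M q)"

definition paracosymplectic :: "walker \<Rightarrow> bool" where
  "paracosymplectic M \<longleftrightarrow> (\<forall>q\<in>chart M. paracosymplectic_at M q)"

type_synonym tensor3 = "real^3 \<Rightarrow> real^3 \<Rightarrow> real^3 \<Rightarrow> real"

definition F :: "walker \<Rightarrow> real^3 \<Rightarrow> tensor3" where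
  "F M q u v w = met M q (nabla_phi M (\<lambda>_. u) (\<lambda>_. v) q) w"

definition trilinear :: "tensor3 \<Rightarrow> bool" where
  "trilinear T \<longleftrightarrow> (\<forall>v w. linear (\<lambda>u. T u v w)) \<and> (\<forall>u w. linear (\<lambda>v. T u v w)) \<and>
     (\<forall>u v. linear (\<lambda>w. T u v w))"

definition theta :: "walker \<Rightarrow> real^3 \<Rightarrow> tensor3 \<Rightarrow> real^3 \<Rightarrow> real" where
  "theta M q T u = (\<Sum>i\<in>UNIV. \<Sum>j\<in>UNIV. ginv M q $ i $ j * T (axis i 1) (axis j 1) u)"

definition theta_star :: "walker \<Rightarrow> real^3 \<Rightarrow> tensor3 \<Rightarrow> real^3 \<Rightarrow> real" where
  "theta_star M q T u =
     (\<Sum>i\<in>UNIV. \<Sum>j\<in>UNIV. ginv M q $ i $ j * T (axis i 1) (phi M q *v axis j 1) u)"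

datatype basic_class = G5 | G6 | G10 | G12

fun class_cond :: "walker \<Rightarrow> real^3 \<Rightarrow> basic_class \<Rightarrow> tensor3 \<Rightarrow> bool" where
  "class_cond M q G5 T \<longleftrightarrow> (\<forall>X Y Z. T X Y Z = theta M q T (xi M q) / 2 *
     (eta M q Y * met M q (phi M q *v X) (phi M q *v Z)
      - eta M q Z * met M q (phi M q *v X) (phi M q *v Y)))"
| "class_cond M q G6 T \<longleftrightarrow> (\<forall>X Y Z. T X Y Z = - (theta_star M q T (xi M q) / 2) *
     (eta M q Y * met M q X (phi M q *v Z) - eta M q Z * met M q X (phi M q *v Y)))"
| "class_cond M q G10 T \<longleftrightarrow>
     (\<forall>X Y Z. T X Y Z = - eta M q Y * T X Z (xi M q) + eta M q Z * T X Y (xi M q)) \<and>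
     (\<forall>X Y. T X Y (xi M q) = T Y X (xi M q) \<and>
            T Y X (xi M q) = T (phi M q *v X) (phi M q *v Y) (xi M q))"
| "class_cond M q G12 T \<longleftrightarrow> (\<forall>X Y Z. T X Y Z = eta M q X *
     (eta M q Y * T (xi M q) (xi M q) Z - eta M q Z * T (xi M q) (xi M q) Y))"

definition class_space :: "walker \<Rightarrow> real^3 \<Rightarrow> basic_class \<Rightarrow> tensor3 set" where
  "class_space M q c = {T. trilinear T \<and> class_cond M q c T}"

(* The zero structure lies in every class, and each class in every larger direct sum. Being in a
   direct sum is therefore understood properly: F is the sum of its projections T c on the classes
   c in I, and none of these projections is zero. The predicate nz on point predicates fixes what
   "is not zero" means for a function or tensor field: nonzero somewhere (Bex (chart M)) or
   nonzero everywhere (Ball (chart M)). *)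
definition properly_in ::
    "((real^3 \<Rightarrow> bool) \<Rightarrow> bool) \<Rightarrow> walker \<Rightarrow> basic_class set \<Rightarrow> bool" where
  "properly_in nz M I \<longleftrightarrow> (\<exists>T :: basic_class \<Rightarrow> real^3 \<Rightarrow> tensor3.
     (\<forall>q\<in>chart M. (\<forall>c\<in>I. T c q \<in> class_space M q c) \<and>
        (\<forall>X Y Z. F M q X Y Z = (\<Sum>c\<in>I. T c q X Y Z))) \<and>
     (\<forall>c\<in>I. nz (\<lambda>q. T c q \<noteq> (\<lambda>X Y Z. 0))))"

(* In the same sense: normal, resp. almost paracosymplectic, and not paracosymplectic. *)
definition properly_normal :: "((real^3 \<Rightarrow> bool) \<Rightarrow> bool) \<Rightarrow> walker \<Rightarrow> bool" where
  "properly_normal nz M \<longleftrightarrow> normal M \<and> nz (\<lambda>q. \<not> paracosymplectic_at M q)"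

definition properly_almost_paracosymplectic ::
    "((real^3 \<Rightarrow> bool) \<Rightarrow> bool) \<Rightarrow> walker \<Rightarrow> bool" where
  "properly_almost_paracosymplectic nz M \<longleftrightarrow>
     almost_paracosymplectic M \<and> nz (\<lambda>q. \<not> paracosymplectic_at M q)"

end

theory Submission
  imports Defs
begin

text \<open>
  In the given coordinates \<open>F(X,Y,Z) = \<beta>(X) (Y\<^sub>2 Z\<^sub>3 - Y\<^sub>3 Z\<^sub>2)\<close> for the 1-form
  \<open>\<beta>(X) = d\<xi>\<^sub>1(X) + X\<^sub>3 (\<xi>\<^sub>1 f\<^sub>x - f\<^sub>y) / 2\<close>, so that every class condition becomes a linear
  condition on the coefficients of \<open>\<beta>\<close>. The kernel of \<open>\<eta>\<close> is spanned by the null eigenvectors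
  \<open>\<partial>\<^sub>x\<close> and \<open>m\<close> of \<open>\<phi>\<close>, with eigenvalues 1 and -1. All tensors in the classes 10 and 12, and \<open>F\<close>
  itself, vanish on \<open>(m, \<xi>, \<partial>\<^sub>x)\<close>, whereas nonzero tensors in the classes 5 and 6 do not; hence the
  components of \<open>F\<close> in the classes 5 and 6 can only be nonzero simultaneously.
\<close>

section \<open>Derivatives in coordinates and inverse matrices\<close>

lemma smooth_on_imp_differentiable:
  assumes "smooth_on U h" "open U" "q \<in> U"
  shows "h differentiable at q"
proof -
  have "Ck_on (Suc 0) U h" using assms(1) unfolding smooth_on_def by blast
  then show ?thesis
    using assms(2,3) by (auto simp: differentiable_on_eq_differentiable_at)
qed

text \<open>Supplies the differentials of \<open>ff\<close> and \<open>xi1\<close> as explicit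
  linear forms in \<open>pd\<close>, so that the derivative rules produce all later formulas
  directly in partial derivatives.\<close>

lemma has_derivative_pd:
  assumes "h differentiable at q"
  shows "(h has_derivative (\<lambda>u. pd 1 h q * u$1 + pd 2 h q * u$2 + pd 3 h q * u$3)) (at q)"
proof -
  let ?D = "frechet_derivative h (at q)"
  have D: "(h has_derivative ?D) (at q)"
    using assms frechet_derivative_works by blast
  interpret D: bounded_linear ?D using D by (rule has_derivative_bounded_linear)
  have "?D u = pd 1 h q * u$1 + pd 2 h q * u$2 + pd 3 h q * u$3" for u
  proof -
    have "?D u = ?D (u$1 *\<^sub>R axis 1 1 + u$2 *\<^sub>R axis 2 1 + u$3 *\<^sub>R axis 3 1)"
      by (rule arg_cong[of _ _ ?D]) (auto simp: vec_eq_iff forall_3 axis_def)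
    also have "\<dots> = pd 1 h q * u$1 + pd 2 h q * u$2 + pd 3 h q * u$3"
      by (simp add: D.add D.scaleR pd_def)
    finally show ?thesis .
  qed
  then show ?thesis using D by (metis (no_types, lifting) ext)
qed

lemma pd_const: "pd i (\<lambda>_. c) q = 0"
  by (simp add: pd_def frechet_derivative_const)

lemma frechet_derivative_const_field:
  "frechet_derivative (\<lambda>_::real^3. c :: 'b::real_normed_vector) (at q) u = 0"
  by (simp add: frechet_derivative_const)

lemma matrix_inv_eqI:
  fixes A :: "'a::semiring_1^'n^'n"
  assumes "A ** B = mat 1" "B ** A = mat 1"
  shows "matrix_inv A = B"
  unfolding matrix_inv_def
proof (rule some_equality)
  fix C assume "A ** C = mat 1 \<and> C ** A = mat 1"
  then show "C = B"
    by (metis assms(1) matrix_mul_assoc matrix_mul_lid matrix_mul_rid)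
qed (use assms in simp)

section \<open>The structure with \<open>xi3 = 0\<close> and \<open>xi2 = - 1\<close>, seen at one
  point\<close>

locale special_walker =
  fixes M :: walker and q :: "real^3"
  assumes open_chart: "open (chart M)"
    and q_in_chart: "q \<in> chart M"
    and xi3_eq: "\<And>r. r \<in> chart M \<Longrightarrow> xi3 M r = 0"
    and xi2_eq: "\<And>r. r \<in> chart M \<Longrightarrow> xi2 M r = - 1"
    and differentiable_ff: "ff M differentiable at q"
    and differentiable_xi1: "xi1 M differentiable at q"
begin

abbreviation "a \<equiv> xi1 M q"
abbreviation "f \<equiv> ff M q"
abbreviation "da u \<equiv> pd 1 (xi1 M) q * u$1 + pd 2 (xi1 M) q * u$2 + pd 3 (xi1 M) q * u$3"
abbreviation "df u \<equiv> pd 1 (ff M) q * u$1 + pd 2 (ff M) q * u$2 + pd 3 (ff M) q * u$3"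
abbreviation "ax \<equiv> pd 1 (xi1 M) q"
abbreviation "ay \<equiv> pd 2 (xi1 M) q"
text \<open>\<open>E / 2\<close> is the coefficient of dz in \<beta>; \<open>ax\<close> and
  \<open>ay\<close> are those of dx and dy.\<close>

abbreviation "E \<equiv> 2 * pd 3 (xi1 M) q + a * pd 1 (ff M) q - pd 2 (ff M) q"

lemmas has_derivative_coeffs [derivative_intros] =
  has_derivative_pd[OF differentiable_ff] has_derivative_pd[OF differentiable_xi1]

text \<open>The structure takes its simple form only on the chart; as the chart is open, this
  already fixes derivatives at \<open>q\<close>.\<close>

lemma frechet_derivative_on_chart:
  assumes "\<And>r. r \<in> chart M \<Longrightarrow> h r = g r" "(g has_derivative g') (at q)"
  shows "frechet_derivative h (at q) = g'"
  using has_derivative_transform_within_open[OF assms(2) open_chart q_in_chart] assms(1)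
  by (metis frechet_derivative_at)

text \<open>Written with scaled basis vectors, not \<open>vector\<close>, so that the derivative
  rules for \<open>*\<^sub>R\<close> and \<open>+\<close> apply to it.\<close>

lemma phi_mult:
  assumes "r \<in> chart M"
  shows "phi M r *v v =
    (v$1 + xi1 M r * v$2 + ff M r * v$3) *\<^sub>R axis 1 1 + (- xi1 M r * v$3) *\<^sub>R axis 2 1
      + (- v$3) *\<^sub>R axis 3 1"
  by (auto simp: phi_def matrix_vector_mult_def sum_3 vec_eq_iff forall_3 axis_def
      xi2_eq[OF assms] xi3_eq[OF assms])

lemma frechet_derivative_phif:
  "frechet_derivative (phif M (\<lambda>_. v)) (at q) u = vector [da u * v$2 + df u * v$3, - da u * v$3, 0]"
proof -
  have "frechet_derivative (phif M (\<lambda>_. v)) (at q) =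
    (\<lambda>u. (da u * v$2 + df u * v$3) *\<^sub>R axis 1 1 + (- da u * v$3) *\<^sub>R axis 2 1)"
  proof (rule frechet_derivative_on_chart)
    show "phif M (\<lambda>_. v) r = (v$1 + xi1 M r * v$2 + ff M r * v$3) *\<^sub>R axis 1 1
      + (- xi1 M r * v$3) *\<^sub>R axis 2 1 + (- v$3) *\<^sub>R axis 3 1" if "r \<in> chart M" for r
      using phi_mult[OF that] by (simp add: phif_def)
  qed (auto intro!: derivative_eq_intros simp: algebra_simps)
  then show ?thesis
    by (auto simp: vec_eq_iff forall_3 axis_def)
qed

section \<open>Metric, Levi-Civita connection and the tensor \<open>F\<close>\<close>

lemma eta_eq: "r \<in> chart M \<Longrightarrow> eta M r u = - u$2 + xi1 M r * u$3"
  by (simp add: eta_def inner_vec_def sum_3 xi2_eq xi3_eq)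

lemma met_eq: "met M r u v = u$1 * v$3 + u$2 * v$2 + u$3 * v$1 + ff M r * u$3 * v$3"
  by (simp add: met_def gmat_def inner_vec_def matrix_vector_mult_def sum_3 algebra_simps)

lemma xi_q: "xi M q = vector [a, -1, 0]"
  by (simp add: xi_def xi2_eq xi3_eq q_in_chart)

lemma ginv_eq: "ginv M r = vector [vector [- ff M r, 0, 1], vector [0, 1, 0], vector [1, 0, 0]]"
  unfolding ginv_def
  by (rule matrix_inv_eqI)
    (auto simp: gmat_def matrix_matrix_mult_def mat_def vec_eq_iff forall_3 sum_3)

lemma pd_gmat: "pd i (\<lambda>r. gmat M r $ j $ l) q = (if j = 3 \<and> l = 3 then pd i (ff M) q else 0)"
  using exhaust_3[of j] exhaust_3[of l] by (auto simp: gmat_def pd_const)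

text \<open>Only the entry \<open>f\<close> of the metric varies. Up to symmetry, the only
  Christoffel symbols left are those with lower indices 13, 23, 33 and upper index 1, and with lower
  indices 33 and upper index 2 or 3.\<close>

lemma nabla_eq:
  "nabla M (\<lambda>_. u) Y q = frechet_derivative Y (at q) u + vector
    [pd 1 (ff M) q * (u$1 * Y q $3 + u$3 * Y q $1) / 2
       + pd 2 (ff M) q * (u$2 * Y q $3 + u$3 * Y q $2) / 2
       + (pd 3 (ff M) q + f * pd 1 (ff M) q) * u$3 * Y q $3 / 2,
     - pd 2 (ff M) q * u$3 * Y q $3 / 2,
     - pd 1 (ff M) q * u$3 * Y q $3 / 2]"
  by (simp add: nabla_def christoffel_def pd_gmat ginv_eq sum_3 vec_eq_iff forall_3 field_simps)

text \<open>Conceptually, g(\<phi> Y, Z) = det(\<xi>, Y, Z), and this determinant is the parallel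
  volume form. Hence F(X,Y,Z) = det(\<open>\<nabla>\<^sub>X \<xi>\<close>, Y, Z), where
  \<open>\<nabla>\<^sub>X \<xi>\<close> is \<beta>(X) times \<open>\<partial>\<^sub>x\<close>. The
  proof is the direct computation.\<close>

lemma F_eq: "F M q u v w = (ax * u$1 + ay * u$2 + E / 2 * u$3)
    * (v$2 * w$3 - v$3 * w$2)"
  by (simp add: F_def nabla_phi_def nabla_eq frechet_derivative_phif met_eq phif_def
      frechet_derivative_const_field phi_mult[OF q_in_chart] axis_def)
    (simp add: field_simps)

lemma trilinear_F: "trilinear (F M q)"
proof -
  \<comment> \<open>Makes the coefficient \<open>E / 2\<close> atomic, so that it is not multiplied
    out.\<close>
  define s where "s = E / 2"
  show ?thesis
    unfolding trilinear_def F_eq s_def[symmetric]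
    by (intro conjI allI linearI) (simp_all add: algebra_simps)
qed

section \<open>Exterior derivatives and normality\<close>

lemma d_eta_eq: "2 * d_eta M (\<lambda>_. u) (\<lambda>_. v) q = da u * v$3 - da v * u$3"
proof -
  \<comment> \<open>\<eta> is -dy + \<open>xi1\<close> dz, so 2 d\<eta> is d\<open>xi1\<close>
    \<and> dz. The connection terms are symmetric in \<open>u\<close> and \<open>v\<close> and
    cancel.\<close>
  have "frechet_derivative (\<lambda>r. eta M r w) (at q) = (\<lambda>u. da u * w$3)" for w
    by (rule frechet_derivative_on_chart[OF eta_eq]) (auto intro!: derivative_eq_intros)
  then show ?thesis
    by (simp add: d_eta_def nabla_eta_def nabla_eq eta_eq[OF q_in_chart]
        frechet_derivative_const_field field_simps)
qed

lemma Phi_eq: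
  assumes "r \<in> chart M"
  shows "Phi M X Y r = X r $1 * Y r $3 - X r $3 * Y r $1
    + xi1 M r * (X r $2 * Y r $3 - X r $3 * Y r $2)"
  by (simp add: Phi_def met_eq phif_def phi_mult[OF assms] axis_def algebra_simps)

text \<open>\<open>Phi\<close> is dx \<and> dz + \<open>xi1\<close> dy \<and> dz, which leaves
  d\<open>xi1\<close> \<and> dy \<and> dz; the brackets of constant fields vanish.\<close>

lemma d_Phi_eq: "3 * d_Phi M (\<lambda>_. u) (\<lambda>_. v) (\<lambda>_. w) q =
  da u * (v$2 * w$3 - v$3 * w$2) + da v * (w$2 * u$3 - w$3 * u$2) + da w * (u$2 * v$3 - u$3 * v$2)"
proof -
  have "frechet_derivative (Phi M (\<lambda>_. v) (\<lambda>_. w)) (at q) =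
      (\<lambda>u. da u * (v$2 * w$3 - v$3 * w$2))" for v w
    by (rule frechet_derivative_on_chart[OF Phi_eq]) (auto intro!: derivative_eq_intros)
  then show ?thesis
    by (simp add: d_Phi_def Phi_eq[OF q_in_chart] lie_def frechet_derivative_const_field)
qed

text \<open>The tensor is alternating and vanishes when one argument is
  \<open>\<partial>\<^sub>x\<close>. Its value on \<open>\<partial>\<^sub>y\<close>,
  \<open>\<partial>\<^sub>z\<close> therefore determines it, and normality becomes two scalar
  equations.\<close>

lemma normality_tensor_eq:
  "nijenhuis M (\<lambda>_. u) (\<lambda>_. v) q - (2 * d_eta M (\<lambda>_. u) (\<lambda>_. v) q) *\<^sub>R xi M q =
   (u$2 * v$3 - u$3 * v$2) *\<^sub>R vector [E + a * ay - f * ax, ay - a * ax, 0]"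
  unfolding d_eta_eq
  by (simp add: nijenhuis_def lie_def frechet_derivative_phif frechet_derivative_const_field
      phif_def phi_mult[OF q_in_chart] xi_q vec_eq_iff forall_3 axis_def)
    (simp add: algebra_simps)

lemma normal_at_iff: "normal_at M q \<longleftrightarrow> ay = a * ax \<and> E + ax * (a\<^sup>2 - f) = 0"
proof -
  have "normal_at M q \<longleftrightarrow> vector [E + a * ay - f * ax, ay - a * ax, 0] = (0 :: real^3)"
    unfolding normal_at_def normality_tensor_eq
  proof
    assume "\<forall>u v :: real^3. (u$2 * v$3 - u$3 * v$2) *\<^sub>R vector [E + a * ay - f * ax, ay - a * ax, 0]
      = (0 :: real^3)"
    from this[rule_format, of "axis 2 1" "axis 3 1"]
    show "vector [E + a * ay - f * ax, ay - a * ax, 0] = (0 :: real^3)"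
      by (simp add: axis_def)
  qed simp
  also have "\<dots> \<longleftrightarrow> ay = a * ax \<and> E + ax * (a\<^sup>2 - f) = 0"
    by (auto simp: vec_eq_iff forall_3 power2_eq_square algebra_simps)
  finally show ?thesis .
qed

text \<open>d\<open>xi1\<close> \<and> dz vanishes exactly when d\<open>xi1\<close> is a multiple of
  dz, and then d\<open>xi1\<close> \<and> dy \<and> dz vanishes as well.\<close>

lemma almost_paracosymplectic_at_iff: "almost_paracosymplectic_at M q \<longleftrightarrow> ax = 0 \<and> ay = 0"
proof
  assume "almost_paracosymplectic_at M q"
  then have "da u * v$3 - da v * u$3 = 0" for u v :: "real^3"
    unfolding almost_paracosymplectic_at_def using d_eta_eq[of u v] by simp
  from this[of "axis 1 1" "axis 3 1"] this[of "axis 2 1" "axis 3 1"]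
  show "ax = 0 \<and> ay = 0" by (simp add: axis_def)
next
  assume *: "ax = 0 \<and> ay = 0"
  show "almost_paracosymplectic_at M q"
    unfolding almost_paracosymplectic_at_def
  proof (intro conjI allI)
    show "d_eta M (\<lambda>_. u) (\<lambda>_. v) q = 0" for u v
      using d_eta_eq[of u v] * by simp
    show "d_Phi M (\<lambda>_. u) (\<lambda>_. v) (\<lambda>_. w) q = 0" for u v w
      using d_Phi_eq[of u v w] * by (simp add: algebra_simps)
  qed
qed

lemma paracosymplectic_at_iff: "paracosymplectic_at M q \<longleftrightarrow> ax = 0 \<and> ay = 0 \<and> E = 0"
  unfolding paracosymplectic_at_def almost_paracosymplectic_at_iff normal_at_iff by auto

section \<open>The null frame and the exclusion of the classes 5 and 6\<close>

definition m :: "real^3" where "m = vector [- (a\<^sup>2 + f) / 2, a, 1]"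

text \<open>The entries of \<open>m\<close> are forced: the third by g(m,
  \<open>\<partial>\<^sub>x\<close>) = 1, the second by \<eta>(m) = 0, the first by g(m, m) =
  0.\<close>

lemma null_frame:
  "phi M q *v axis 1 1 = axis 1 1" "phi M q *v m = - m"
  "eta M q (axis 1 1) = 0" "eta M q m = 0" "eta M q (xi M q) = 1" "met M q m (axis 1 1) = 1"
  by (auto simp: phi_mult eta_eq q_in_chart met_eq m_def xi_q axis_def vec_eq_iff forall_3
      power2_eq_square field_simps)

text \<open>In both classes \<open>T\<close> is a scalar times a fixed tensor. The null frame gives
  this fixed tensor a nonzero value at (m, \<xi>, \<open>\<partial>\<^sub>x\<close>), where
  \<open>T\<close> equals minus half of \<open>theta\<close> or \<open>theta_star\<close> at \<xi>;
  so the scalar must vanish.\<close>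

lemma G5_G6_nonzero:
  assumes "class_cond M q c T" "c = G5 \<or> c = G6" "T m (xi M q) (axis 1 1) = 0"
  shows "T = (\<lambda>X Y Z. 0)"
  using assms(2)
proof
  assume c: "c = G5"
  have T: "T X Y Z = theta M q T (xi M q) / 2 *
     (eta M q Y * met M q (phi M q *v X) (phi M q *v Z)
      - eta M q Z * met M q (phi M q *v X) (phi M q *v Y))" for X Y Z
    using assms(1) unfolding c class_cond.simps by blast
  have "met M q (- m) (axis 1 1) = - 1"
    using null_frame(6) by (simp add: met_eq)
  then have "theta M q T (xi M q) = 0"
    using T[of m "xi M q" "axis 1 1"] assms(3) by (simp add: null_frame)
  then show ?thesis by (intro ext) (subst T, simp)
next
  assume c: "c = G6"
  have T: "T X Y Z = - (theta_star M q T (xi M q) / 2) *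
     (eta M q Y * met M q X (phi M q *v Z) - eta M q Z * met M q X (phi M q *v Y))" for X Y Z
    using assms(1) unfolding c class_cond.simps by blast
  have "theta_star M q T (xi M q) = 0"
    using T[of m "xi M q" "axis 1 1"] assms(3) by (simp add: null_frame)
  then show ?thesis by (intro ext) (subst T, simp)
qed

text \<open>In class 10 the value is -T(m, \<open>\<partial>\<^sub>x\<close>, \<xi>), and invariance
  under \<phi>, with eigenvalues -1 and 1, makes it equal to its own negative. In class 12 the
  factor \<eta>(m) is 0.\<close>

lemma G10_G12_vanish:
  assumes "T \<in> class_space M q c" "c = G10 \<or> c = G12"
  shows "T m (xi M q) (axis 1 1) = 0"
  using assms(2)
proof
  assume c: "c = G10"
  have lin: "trilinear T" and G10: "class_cond M q G10 T"
    using assms(1) unfolding c class_space_def by blast+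
  have T: "T X Y Z = - eta M q Y * T X Z (xi M q) + eta M q Z * T X Y (xi M q)"
    and T_xi: "T X Y (xi M q) = T (phi M q *v X) (phi M q *v Y) (xi M q)" for X Y Z
    using G10[unfolded class_cond.simps, THEN conjunct1, rule_format, of X Y Z]
      G10[unfolded class_cond.simps, THEN conjunct2, rule_format, of X Y]
    by linarith+
  have "linear (\<lambda>u. T u (axis 1 1) (xi M q))"
    using lin unfolding trilinear_def by blast
  then have "T (- m) (axis 1 1) (xi M q) = - T m (axis 1 1) (xi M q)"
    by (rule linear_neg)
  then have "T m (axis 1 1) (xi M q) = 0"
    using T_xi[of m "axis 1 1"] by (simp add: null_frame)
  then show ?thesis
    using T[of m "xi M q" "axis 1 1"] by (simp add: null_frame)
next
  assume c: "c = G12"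
  have "class_cond M q G12 T"
    using assms(1) unfolding c class_space_def by blast
  from this[unfolded class_cond.simps, rule_format, of m "xi M q" "axis 1 1"]
  show ?thesis unfolding null_frame(4) mult_zero_left .
qed

lemma F_null_frame: "F M q m (xi M q) (axis 1 1) = 0"
  by (simp add: F_eq xi_q axis_def)

section \<open>The class 12 and the vanishing of \<open>F\<close>\<close>

lemma F_in_G12_iff: "F M q \<in> class_space M q G12 \<longleftrightarrow> ax = 0 \<and> 2 * a * ay + E = 0"
proof -
  \<comment> \<open>\<open>?k\<close> is \<beta> - \<beta>(\<xi>) \<eta>, with \<beta>(\<xi>) =
    \<open>a * ax - ay\<close>. Thus \<open>F\<close> lies in class 12 iff \<beta> is a multiple of
    \<eta>.\<close>
  let ?k = "\<lambda>X :: real^3. ax * X$1 + a * ax * X$2 + (E / 2 - a * (a * ax - ay)) * X$3"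
  have k: "F M q X Y Z - eta M q X * (eta M q Y * F M q (xi M q) (xi M q) Z
      - eta M q Z * F M q (xi M q) (xi M q) Y) = ?k X * (Y$2 * Z$3 - Y$3 * Z$2)" for X Y Z
  proof -
    have F_xi: "F M q (xi M q) (xi M q) W = (a * ax - ay) * (- W$3)" for W
      by (simp add: F_eq xi_q)
    \<comment> \<open>The terms containing \<open>a\<close> cancel: \<eta> \<and> (-dz) = dy \<and>
      dz.\<close>
    have wedge: "eta M q Y * (- Z$3) - eta M q Z * (- Y$3) = Y$2 * Z$3 - Y$3 * Z$2"
      by (simp add: eta_eq[OF q_in_chart] algebra_simps)
    have "eta M q Y * F M q (xi M q) (xi M q) Z - eta M q Z * F M q (xi M q) (xi M q) Y
      = (a * ax - ay) * (eta M q Y * (- Z$3) - eta M q Z * (- Y$3))"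
      unfolding F_xi by (simp only: right_diff_distrib mult.left_commute)
    also have "\<dots> = (a * ax - ay) * (Y$2 * Z$3 - Y$3 * Z$2)"
      unfolding wedge ..
    finally have "F M q X Y Z - eta M q X * (eta M q Y * F M q (xi M q) (xi M q) Z
        - eta M q Z * F M q (xi M q) (xi M q) Y)
      = (ax * X$1 + ay * X$2 + E / 2 * X$3 - eta M q X * (a * ax - ay))
        * (Y$2 * Z$3 - Y$3 * Z$2)"
      by (simp only: F_eq left_diff_distrib mult.assoc)
    \<comment> \<open>Stated for arbitrary \<open>s\<close>, which keeps \<open>E / 2\<close>
      intact.\<close>
    moreover have "ax * X$1 + ay * X$2 + s * X$3 - eta M q X * (a * ax - ay)
        = ax * X$1 + a * ax * X$2 + (s - a * (a * ax - ay)) * X$3" for s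
      by (simp add: eta_eq[OF q_in_chart] algebra_simps)
    ultimately show ?thesis by (simp only:)
  qed
  have "F M q \<in> class_space M q G12 \<longleftrightarrow>
      (\<forall>X Y Z. F M q X Y Z - eta M q X * (eta M q Y * F M q (xi M q) (xi M q) Z
        - eta M q Z * F M q (xi M q) (xi M q) Y) = 0)"
    unfolding class_space_def class_cond.simps mem_Collect_eq right_minus_eq
    using trilinear_F by blast
  also have "\<dots> \<longleftrightarrow> (\<forall>X. ?k X = 0)"
    unfolding k
  proof
    assume *: "\<forall>X Y Z :: real^3. ?k X * (Y$2 * Z$3 - Y$3 * Z$2) = 0"
    show "\<forall>X. ?k X = 0"
    proof
      show "?k X = 0" for X
        using *[rule_format, of X "axis 2 1" "axis 3 1"] by (simp add: axis_def)
    qed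
  qed simp
  also have "\<dots> \<longleftrightarrow> ax = 0 \<and> E / 2 - a * (a * ax - ay) = 0"
  proof
    assume *: "\<forall>X. ?k X = 0"
    show "ax = 0 \<and> E / 2 - a * (a * ax - ay) = 0"
      using *[rule_format, of "axis 1 1"] *[rule_format, of "axis 3 1"] by (simp add: axis_def)
  qed simp
  also have "\<dots> \<longleftrightarrow> ax = 0 \<and> 2 * a * ay + E = 0"
  proof (rule conj_cong[OF refl])
    assume "ax = 0"
    then have "2 * a * ay + E = 2 * (E / 2 - a * (a * ax - ay))" by simp
    then show "E / 2 - a * (a * ax - ay) = 0 \<longleftrightarrow> 2 * a * ay + E = 0" by (simp only: mult_eq_0_iff) simp
  qed
  finally show ?thesis .
qed

lemma F_eq_0_iff: "F M q = (\<lambda>X Y Z. 0) \<longleftrightarrow> ax = 0 \<and> ay = 0 \<and> E = 0"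
proof
  assume "F M q = (\<lambda>X Y Z. 0)"
  then have "F M q u (axis 2 1) (axis 3 1) = 0" for u by simp
  from this[of "axis 1 1"] this[of "axis 2 1"] this[of "axis 3 1"]
  show "ax = 0 \<and> ay = 0 \<and> E = 0" by (simp add: F_eq axis_def)
next
  assume "ax = 0 \<and> ay = 0 \<and> E = 0"
  then show "F M q = (\<lambda>X Y Z. 0)" unfolding F_eq by simp
qed

end

section \<open>From single points to the whole chart\<close>

theorem theorem4p5:
  fixes M :: walker and nz :: "(real^3 \<Rightarrow> bool) \<Rightarrow> bool"
  assumes M: "apcm_walker M"
    and xi3: "\<forall>q\<in>chart M. xi3 M q = 0"
    and xi2: "\<forall>q\<in>chart M. xi2 M q = - 1"
    and nz: "nz \<in> {Bex (chart M), Ball (chart M)}"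
  shows
    "(\<forall>I \<in> {{G5}, {G5, G10}, {G5, G12}, {G5, G10, G12},
            {G6}, {G6, G10}, {G6, G12}, {G6, G10, G12}}. \<not> properly_in nz M I)
   \<and> (paracosymplectic M \<longleftrightarrow>
        (\<forall>q\<in>chart M. pd 1 (xi1 M) q = 0 \<and> pd 2 (xi1 M) q = 0 \<and>
           2 * pd 3 (xi1 M) q + xi1 M q * pd 1 (ff M) q - pd 2 (ff M) q = 0))
   \<and> (properly_normal nz M \<longleftrightarrow>
        nz (\<lambda>q. pd 1 (xi1 M) q \<noteq> 0) \<and>
        (\<forall>q\<in>chart M. pd 2 (xi1 M) q = xi1 M q * pd 1 (xi1 M) q \<and>
           2 * pd 3 (xi1 M) q + xi1 M q * pd 1 (ff M) q - pd 2 (ff M) q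
             + pd 1 (xi1 M) q * ((xi1 M q)\<^sup>2 - ff M q) = 0))
   \<and> (properly_almost_paracosymplectic nz M \<longleftrightarrow>
        (\<forall>q\<in>chart M. pd 1 (xi1 M) q = 0 \<and> pd 2 (xi1 M) q = 0) \<and>
        nz (\<lambda>q. 2 * pd 3 (xi1 M) q + xi1 M q * pd 1 (ff M) q - pd 2 (ff M) q \<noteq> 0))
   \<and> (properly_in nz M {G12} \<longleftrightarrow>
        (\<forall>q\<in>chart M. pd 1 (xi1 M) q = 0) \<and>
        nz (\<lambda>q. pd 2 (xi1 M) q \<noteq> 0) \<and>
        (\<forall>q\<in>chart M. 2 * xi1 M q * pd 2 (xi1 M) q + 2 * pd 3 (xi1 M) q
           + xi1 M q * pd 1 (ff M) q - pd 2 (ff M) q = 0))"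
proof -
  have ne: "chart M \<noteq> {}" using M by (auto simp: apcm_walker_def)
  have sw: "special_walker M q" if "q \<in> chart M" for q
    by standard (use M xi2 xi3 that in
      \<open>auto simp: apcm_walker_def intro: smooth_on_imp_differentiable\<close>)
  \<comment> \<open>\<open>nz\<close> enters only through this congruence and the existence of a
    witness below, so both readings of "not zero" are handled at once.\<close>
  have nz_cong: "nz P \<longleftrightarrow> nz Q" if "\<And>q. q \<in> chart M \<Longrightarrow> P q \<longleftrightarrow> Q q" for P Q
    using nz that by auto
  have nz_ex: "\<exists>q\<in>chart M. P q" if "nz P" for P
    using nz that ne by auto
  \<comment> \<open>All eight sums have this shape. At a point where the component in
    \<open>c\<close> is nonzero, evaluation at (m, \<xi>, \<open>\<partial>\<^sub>x\<close>) kills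
    \<open>F\<close> and the components in \<open>J\<close>, and hence that component too.\<close>
  have not_in: "\<not> properly_in nz M (insert c J)"
    if c: "c = G5 \<or> c = G6" and J: "J \<subseteq> {G10, G12}" for c J
  proof
    assume "properly_in nz M (insert c J)"
    then obtain T where
      TF: "\<forall>q\<in>chart M. (\<forall>d\<in>insert c J. T d q \<in> class_space M q d) \<and>
        (\<forall>X Y Z. F M q X Y Z = (\<Sum>d\<in>insert c J. T d q X Y Z))"
      and nonzero: "\<forall>d\<in>insert c J. nz (\<lambda>q. T d q \<noteq> (\<lambda>X Y Z. 0))"
      unfolding properly_in_def by (elim exE conjE)
    have T: "T d q \<in> class_space M q d" if "q \<in> chart M" "d \<in> insert c J" for q d
      using TF that by blast
    have F: "F M q X Y Z = (\<Sum>d\<in>insert c J. T d q X Y Z)" if "q \<in> chart M" for q X Y Z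
      using TF that by blast
    have "nz (\<lambda>q. T c q \<noteq> (\<lambda>X Y Z. 0))"
      using nonzero by blast
    then obtain q where q: "q \<in> chart M" and Tq: "T c q \<noteq> (\<lambda>X Y Z. 0)"
      using nz_ex by blast
    interpret special_walker M q using sw[OF q] .
    have fin: "finite J" "c \<notin> J" using J c by (auto intro: finite_subset)
    have "T d q m (xi M q) (axis 1 1) = 0" if "d \<in> J" for d
      using G10_G12_vanish T[OF q, of d] J that by blast
    then have "T c q m (xi M q) (axis 1 1) = 0"
      using F[OF q, of m "xi M q" "axis 1 1"] fin by (simp add: F_null_frame)
    moreover have "class_cond M q c (T c q)"
      using T[OF q, of c] by (simp add: class_space_def)
    ultimately show False using G5_G6_nonzero c Tq by blast
  qed
  note normal_iff = special_walker.normal_at_iff[OF sw]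
  note ap_iff = special_walker.almost_paracosymplectic_at_iff[OF sw]
  note pc_iff = special_walker.paracosymplectic_at_iff[OF sw]
  note G12_iff = special_walker.F_in_G12_iff[OF sw]
  note F_0_iff = special_walker.F_eq_0_iff[OF sw]
  have i: "\<forall>I \<in> {{G5}, {G5, G10}, {G5, G12}, {G5, G10, G12},
            {G6}, {G6, G10}, {G6, G12}, {G6, G10, G12}}. \<not> properly_in nz M I"
    by (simp add: not_in)
  have ii: "paracosymplectic M \<longleftrightarrow>
        (\<forall>q\<in>chart M. pd 1 (xi1 M) q = 0 \<and> pd 2 (xi1 M) q = 0 \<and>
           2 * pd 3 (xi1 M) q + xi1 M q * pd 1 (ff M) q - pd 2 (ff M) q = 0)"
    unfolding paracosymplectic_def using pc_iff by simp
  have iii: "properly_normal nz M \<longleftrightarrow>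
        nz (\<lambda>q. pd 1 (xi1 M) q \<noteq> 0) \<and>
        (\<forall>q\<in>chart M. pd 2 (xi1 M) q = xi1 M q * pd 1 (xi1 M) q \<and>
           2 * pd 3 (xi1 M) q + xi1 M q * pd 1 (ff M) q - pd 2 (ff M) q
             + pd 1 (xi1 M) q * ((xi1 M q)\<^sup>2 - ff M q) = 0)"
  proof -
    \<comment> \<open>Under the two normality equations, \<open>ax = 0\<close> already forces
      \<open>ay = 0\<close> and \<open>E = 0\<close>.\<close>
    have "nz (\<lambda>q. \<not> paracosymplectic_at M q) \<longleftrightarrow> nz (\<lambda>q. pd 1 (xi1 M) q \<noteq> 0)" if "normal M"
    proof (rule nz_cong)
      fix q assume q: "q \<in> chart M"
      then have "normal_at M q" using that by (simp add: normal_def)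
      then show "\<not> paracosymplectic_at M q \<longleftrightarrow> pd 1 (xi1 M) q \<noteq> 0"
        unfolding normal_iff[OF q] pc_iff[OF q] by auto
    qed
    moreover have "normal M \<longleftrightarrow> (\<forall>q\<in>chart M. pd 2 (xi1 M) q = xi1 M q * pd 1 (xi1 M) q \<and>
           2 * pd 3 (xi1 M) q + xi1 M q * pd 1 (ff M) q - pd 2 (ff M) q
             + pd 1 (xi1 M) q * ((xi1 M q)\<^sup>2 - ff M q) = 0)"
      unfolding normal_def using normal_iff by simp
    ultimately show ?thesis unfolding properly_normal_def by blast
  qed
  have iv: "properly_almost_paracosymplectic nz M \<longleftrightarrow>
        (\<forall>q\<in>chart M. pd 1 (xi1 M) q = 0 \<and> pd 2 (xi1 M) q = 0) \<and>
        nz (\<lambda>q. 2 * pd 3 (xi1 M) q + xi1 M q * pd 1 (ff M) q - pd 2 (ff M) q \<noteq> 0)"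
  proof -
    have ap: "almost_paracosymplectic M \<longleftrightarrow>
        (\<forall>q\<in>chart M. pd 1 (xi1 M) q = 0 \<and> pd 2 (xi1 M) q = 0)"
      unfolding almost_paracosymplectic_def using ap_iff by simp
    \<comment> \<open>With \<open>ax = ay = 0\<close> given, only \<open>E = 0\<close> separates the
      two notions.\<close>
    moreover have "nz (\<lambda>q. \<not> paracosymplectic_at M q) \<longleftrightarrow>
        nz (\<lambda>q. 2 * pd 3 (xi1 M) q + xi1 M q * pd 1 (ff M) q - pd 2 (ff M) q \<noteq> 0)"
      if "almost_paracosymplectic M"
      using that unfolding ap by (intro nz_cong) (simp add: pc_iff)
    ultimately show ?thesis unfolding properly_almost_paracosymplectic_def by blast
  qed
  have v: "properly_in nz M {G12} \<longleftrightarrow>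
        (\<forall>q\<in>chart M. pd 1 (xi1 M) q = 0) \<and>
        nz (\<lambda>q. pd 2 (xi1 M) q \<noteq> 0) \<and>
        (\<forall>q\<in>chart M. 2 * xi1 M q * pd 2 (xi1 M) q + 2 * pd 3 (xi1 M) q
           + xi1 M q * pd 1 (ff M) q - pd 2 (ff M) q = 0)"
  proof -
    \<comment> \<open>With a single summand, the component is \<open>F\<close> itself.\<close>
    have "properly_in nz M {G12} \<longleftrightarrow>
        (\<forall>q\<in>chart M. F M q \<in> class_space M q G12) \<and> nz (\<lambda>q. F M q \<noteq> (\<lambda>X Y Z. 0))"
    proof
      assume "properly_in nz M {G12}"
      then obtain T where
        TF: "\<forall>q\<in>chart M. (\<forall>d\<in>{G12}. T d q \<in> class_space M q d) \<and>
          (\<forall>X Y Z. F M q X Y Z = (\<Sum>d\<in>{G12}. T d q X Y Z))"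
        and nonzero: "\<forall>d\<in>{G12}. nz (\<lambda>q. T d q \<noteq> (\<lambda>X Y Z. 0))"
        unfolding properly_in_def by (elim exE conjE)
      have "F M q = T G12 q" if "q \<in> chart M" for q
        using TF that by (intro ext) simp
      with TF nonzero show "(\<forall>q\<in>chart M. F M q \<in> class_space M q G12) \<and> nz (\<lambda>q. F M q \<noteq> (\<lambda>X Y Z. 0))"
        using nz_cong[of "\<lambda>q. T G12 q \<noteq> (\<lambda>X Y Z. 0)" "\<lambda>q. F M q \<noteq> (\<lambda>X Y Z. 0)"] by simp
    next
      assume "(\<forall>q\<in>chart M. F M q \<in> class_space M q G12) \<and> nz (\<lambda>q. F M q \<noteq> (\<lambda>X Y Z. 0))"
      then show "properly_in nz M {G12}"
        unfolding properly_in_def by (intro exI[of _ "\<lambda>_. F M"]) simp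
    qed
    \<comment> \<open>In class 12, \<open>ax = 0\<close> and \<open>E = - 2 * a * ay\<close>, so
      \<open>F\<close> vanishes exactly when \<open>ay\<close> does.\<close>
    moreover have "nz (\<lambda>q. F M q \<noteq> (\<lambda>X Y Z. 0)) \<longleftrightarrow> nz (\<lambda>q. pd 2 (xi1 M) q \<noteq> 0)"
      if "\<forall>q\<in>chart M. F M q \<in> class_space M q G12"
    proof (rule nz_cong)
      fix q assume q: "q \<in> chart M"
      then have "F M q \<in> class_space M q G12" using that by blast
      then show "F M q \<noteq> (\<lambda>X Y Z. 0) \<longleftrightarrow> pd 2 (xi1 M) q \<noteq> 0"
        unfolding G12_iff[OF q] F_0_iff[OF q] by auto
    qed
    moreover have "(\<forall>q\<in>chart M. F M q \<in> class_space M q G12) \<longleftrightarrow>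
        (\<forall>q\<in>chart M. pd 1 (xi1 M) q = 0) \<and>
        (\<forall>q\<in>chart M. 2 * xi1 M q * pd 2 (xi1 M) q + 2 * pd 3 (xi1 M) q
           + xi1 M q * pd 1 (ff M) q - pd 2 (ff M) q = 0)"
      unfolding ball_conj_distrib[symmetric]
      by (rule ball_cong[OF refl]) (simp add: G12_iff add_ac add_diff_eq)
    ultimately show ?thesis by blast
  qed
  show ?thesis using i ii iii iv v by blast
qed

end
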